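(* Let $k\ge1$ be an integer. Every vector field on $\Omega$ whose three components are polynomials in $(\xi,\eta,\zeta)$ of total degree at most $k-1$ belongs to $\mathcal U^{(1),k}(\Omega)$; that is, $(P^{k-1})^3\subset\mathcal U^{(1),k}(\Omega)$.
   Context: $\Omega=\{(\xi,\eta,\zeta)\in\mathbb R^3:\xi,\eta,\zeta\ge0,\ \xi\le1-\zeta,\ \eta\le1-\zeta\}$; $\Omega_\infty=\{(x,y,z):0\le x,y\le1,\ z\ge0\}$; $\phi:\Omega_\infty\to\Omega$, $\phi(x,y,z)=\left(\frac{x}{1+z},\frac{y}{1+z},\frac{z}{1+z}\right)$, a diffeomorphism onto $\Omega$ minus its apex $(0,0,1)$. For 1-forms (vector fields $E$) $\phi^*E=D\phi^T(E\circ\phi)$, and $(\phi^{-1})^*=(\phi^* )^{-1}$. $Q^{l,m,n}$: polynomials of degree at most $l,m,n$ in $x,y,z$; $Q^{l,m,n}_k=\{u/(1+z)^k:u\in Q^{l,m,n}\}$; $P^n_k[w,z]=\{u(w,z)/(1+z)^k:u$ polynomial of total degree $\le n\}$; $\tilde P^{k-1}_{k+1}[w,1+z]=\frac{1}{(1+z)^{k+1}}\mathrm{span}\{w^a(1+z)^{k-1-a}:0\le a\le k-1\}$. Polynomial spaces with a negative degree are $\{0\}$. $\mathcal U^{(1),k}(\Omega_\infty)$ is the set of all $u\in Q_{k+1}^{k-1,k,k-1}\times Q_{k+1}^{k,k-1,k-1}\times Q_{k+1}^{k,k,k-2}\oplus\{\frac{z^{k-1}}{(1+z)^{k+1}}(r_xz,r_yz,-r)^T:r\in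 Q^{k,k}[x,y]\}$ (subscripts on $r$ are partial derivatives) such that on the faces $y=0,1$ (with $w=x$) the tangential components satisfy $(u_1,u_3)\in(P^{k-1}_{k+1}[w,z])^2\oplus\tilde P^{k-1}_{k+1}[w,1+z](1+z,-w)^T$, and on the faces $x=0,1$ (with $w=y$) $(u_2,u_3)$ lies in the same space. $\mathcal U^{(1),k}(\Omega)=(\phi^{-1})^*\mathcal U^{(1),k}(\Omega_\infty)$. *)

theory Defs
  imports "HOL-Analysis.Analysis"
begin

definition Omega :: "(real^3) set" where
  "Omega = {p. p$1 \<ge> 0 \<and> p$2 \<ge> 0 \<and> p$3 \<ge> 0 \<and> p$1 \<le> 1 - p$3 \<and> p$2 \<le> 1 - p$3}"

definition apex :: "real^3" where
  "apex = vector [0, 0, 1]"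

definition Omega_inf :: "(real^3) set" where
  "Omega_inf = {p. 0 \<le> p$1 \<and> p$1 \<le> 1 \<and> 0 \<le> p$2 \<and> p$2 \<le> 1 \<and> p$3 \<ge> 0}"

definition phi :: "real^3 \<Rightarrow> real^3" where
  "phi p = vector [p$1 / (1 + p$3), p$2 / (1 + p$3), p$3 / (1 + p$3)]"

text \<open>
  A vector field on a set \<open>S\<close> is an element of \<^term>\<open>extensional S\<close>, so that two fields are equal
  iff they agree on \<open>S\<close>. The formula for \<^const>\<open>phi\<close> makes sense near every point of
  \<^const>\<open>Omega_inf\<close>, boundary included, hence the two-sided Jacobian below. Since the image of
  \<^const>\<open>phi\<close> misses the apex, pulling back identifies fields on \<^term>\<open>Omega - {apex}\<close> with fields on
  \<^const>\<open>Omega_inf\<close> (lemma \<open>bij_betw_pullback1\<close>).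
\<close>

definition pullback1 :: "(real^3 \<Rightarrow> real^3) \<Rightarrow> (real^3 \<Rightarrow> real^3)" where
  "pullback1 E = (\<lambda>p\<in>Omega_inf. transpose (jacobian phi (at p)) *v E (phi p))"

definition inv_pullback1 :: "(real^3 \<Rightarrow> real^3) \<Rightarrow> (real^3 \<Rightarrow> real^3)" where
  "inv_pullback1 = the_inv_into (extensional (Omega - {apex})) pullback1"

text \<open>
  Degrees are integers: for a negative degree the index set of the sum is empty and the space is
  \<open>{0}\<close>.
\<close>

definition polyQ2 :: "int \<Rightarrow> int \<Rightarrow> (real \<Rightarrow> real \<Rightarrow> real) set" where
  "polyQ2 l m = {r. \<exists>c :: nat \<Rightarrow> nat \<Rightarrow> real. \<forall>x y.
     r x y = (\<Sum>i | int i \<le> l. \<Sum>j | int j \<le> m. c i j * x^i * y^j)}"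

definition polyQ3 :: "int \<Rightarrow> int \<Rightarrow> int \<Rightarrow> (real \<Rightarrow> real \<Rightarrow> real \<Rightarrow> real) set" where
  "polyQ3 l m n = {u. \<exists>c :: nat \<Rightarrow> nat \<Rightarrow> nat \<Rightarrow> real. \<forall>x y z.
     u x y z = (\<Sum>i | int i \<le> l. \<Sum>j | int j \<le> m. \<Sum>t | int t \<le> n. c i j t * x^i * y^j * z^t)}"

definition polyP2 :: "int \<Rightarrow> (real \<Rightarrow> real \<Rightarrow> real) set" where
  "polyP2 n = {u. \<exists>c :: nat \<Rightarrow> nat \<Rightarrow> real. \<forall>w z.
     u w z = (\<Sum>(i, j) | int (i + j) \<le> n. c i j * w^i * z^j)}"

definition polyP3 :: "int \<Rightarrow> (real \<Rightarrow> real \<Rightarrow> real \<Rightarrow> real) set" where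
  "polyP3 n = {u. \<exists>c :: nat \<Rightarrow> nat \<Rightarrow> nat \<Rightarrow> real. \<forall>x y z.
     u x y z = (\<Sum>(i, j, t) | int (i + j + t) \<le> n. c i j t * x^i * y^j * z^t)}"

definition ratQ3 :: "nat \<Rightarrow> int \<Rightarrow> int \<Rightarrow> int \<Rightarrow> (real \<Rightarrow> real \<Rightarrow> real \<Rightarrow> real) set" where
  "ratQ3 k l m n = {\<lambda>x y z. u x y z / (1 + z)^k | u. u \<in> polyQ3 l m n}"

definition ratP2 :: "nat \<Rightarrow> int \<Rightarrow> (real \<Rightarrow> real \<Rightarrow> real) set" where
  "ratP2 k n = {\<lambda>w z. u w z / (1 + z)^k | u. u \<in> polyP2 n}"

text \<open>Homogeneous polynomials of degree \<open>n\<close> in \<open>w\<close> and \<open>1 + z\<close>, divided by \<open>(1 + z)\<^sup>k\<close>.\<close>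

definition rat_homP2 :: "nat \<Rightarrow> int \<Rightarrow> (real \<Rightarrow> real \<Rightarrow> real) set" where
  "rat_homP2 k n = {u. \<exists>c :: nat \<Rightarrow> real. \<forall>w z.
     u w z = (\<Sum>a | int a \<le> n. c a * w^a * (1 + z)^nat (n - int a)) / (1 + z)^k}"

definition volume1 :: "nat \<Rightarrow> (real^3 \<Rightarrow> real^3) set" where
  "volume1 k = {u \<in> extensional Omega_inf.
     \<exists>f \<in> ratQ3 (k + 1) (int k - 1) (int k) (int k - 1).
     \<exists>g \<in> ratQ3 (k + 1) (int k) (int k - 1) (int k - 1).
     \<exists>h \<in> ratQ3 (k + 1) (int k) (int k) (int k - 2).
     \<exists>r \<in> polyQ2 (int k) (int k).
       \<forall>x y z. vector [x, y, z] \<in> Omega_inf \<longrightarrow>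
         u (vector [x, y, z]) =
           vector [f x y z, g x y z, h x y z]
           + (z^(k - 1) / (1 + z)^(k + 1)) *\<^sub>R
               vector [deriv (\<lambda>s. r s y) x * z, deriv (\<lambda>s. r x s) y * z, - r x y]}"

definition face_traces1 :: "nat \<Rightarrow> (real \<Rightarrow> real \<Rightarrow> real \<times> real) set" where
  "face_traces1 k =
     {\<lambda>w z. (p w z + q w z * (1 + z), p' w z + q w z * (- w)) | p p' q.
        p \<in> ratP2 (k + 1) (int k - 1) \<and> p' \<in> ratP2 (k + 1) (int k - 1) \<and>
        q \<in> rat_homP2 (k + 1) (int k - 1)}"

definition U1_inf :: "nat \<Rightarrow> (real^3 \<Rightarrow> real^3) set" where
  "U1_inf k = {u \<in> volume1 k.
     (\<forall>y \<in> {0, 1}. \<exists>T \<in> face_traces1 k. \<forall>w z. 0 \<le> w \<and> w \<le> 1 \<and> 0 \<le> z \<longrightarrow>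
        (u (vector [w, y, z]) $ 1, u (vector [w, y, z]) $ 3) = T w z) \<and>
     (\<forall>x \<in> {0, 1}. \<exists>T \<in> face_traces1 k. \<forall>w z. 0 \<le> w \<and> w \<le> 1 \<and> 0 \<le> z \<longrightarrow>
        (u (vector [x, w, z]) $ 2, u (vector [x, w, z]) $ 3) = T w z)}"

definition U1 :: "nat \<Rightarrow> (real^3 \<Rightarrow> real^3) set" where
  "U1 k = inv_pullback1 ` U1_inf k"

definition poly_fields :: "int \<Rightarrow> (real^3 \<Rightarrow> real^3) set" where
  "poly_fields n = {\<lambda>p\<in>Omega. vector [f (p$1) (p$2) (p$3), g (p$1) (p$2) (p$3), h (p$1) (p$2) (p$3)]
     | f g h. f \<in> polyP3 n \<and> g \<in> polyP3 n \<and> h \<in> polyP3 n}"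

lemma has_derivative_phi:
  assumes "p$3 \<ge> 0"
  shows "(phi has_derivative (\<lambda>h. vector [
            h$1 / (1 + p$3) - p$1 * h$3 / (1 + p$3)^2,
            h$2 / (1 + p$3) - p$2 * h$3 / (1 + p$3)^2,
            h$3 / (1 + p$3)^2])) (at p)"
proof -
  have nz: "1 + p$3 \<noteq> 0" using assms by linarith
  have D: "((\<lambda>p::real^3. p$i) has_derivative (\<lambda>h. h$i)) (at p)" for i
    by (rule bounded_linear.has_derivative[OF bounded_linear_vec_nth has_derivative_ident])
  have "((\<lambda>p. p$i / (1 + p$3)) has_derivative
      (\<lambda>h. h$i / (1 + p$3) - p$i * h$3 / (1 + p$3)^2)) (at p)" for i
    by (rule has_derivative_eq_rhs, (rule derivative_intros D nz)+)
       (use nz in \<open>auto simp: fun_eq_iff field_simps power2_eq_square\<close>)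
  note * = this
  have 3: "((\<lambda>p. p$3 / (1 + p$3)) has_derivative (\<lambda>h. h$3 / (1 + p$3)^2)) (at p)"
    by (rule has_derivative_eq_rhs[OF *])
       (use nz in \<open>simp add: fun_eq_iff divide_simps power2_eq_square; simp add: algebra_simps\<close>)
  show ?thesis
    unfolding has_derivative_componentwise_within[of phi]
    by (auto simp: Basis_vec_def inner_axis phi_def forall_3 intro!: * 3)
qed

lemma invertible_jacobian_phi:
  assumes "p$3 \<ge> 0"
  shows "invertible (transpose (jacobian phi (at p)))"
proof -
  have "jacobian phi (at p) = (\<chi> i j. vector [
            axis j 1$1 / (1 + p$3) - p$1 * axis j 1$3 / (1 + p$3)^2,
            axis j 1$2 / (1 + p$3) - p$2 * axis j 1$3 / (1 + p$3)^2,
            axis j 1$3 / (1 + p$3)^2] $ i)"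
    unfolding jacobian_def frechet_derivative_at[OF has_derivative_phi[OF assms], symmetric]
      matrix_def ..
  then have "det (jacobian phi (at p)) = 1 / (1 + p$3)^4"
    using assms by (simp add: det_3 axis_def power2_eq_square power4_eq_xxxx)
  then show ?thesis
    using assms by (simp add: invertible_det_nz)
qed

lemma bij_betw_phi: "bij_betw phi Omega_inf (Omega - {apex})"
proof (rule bij_betw_byWitness[where
      f' = "\<lambda>q. vector [q$1 / (1 - q$3), q$2 / (1 - q$3), q$3 / (1 - q$3)]"])
  have lt: "q$3 < 1" if "q \<in> Omega - {apex}" for q :: "real^3"
    using that by (auto simp: Omega_def apex_def vec_eq_iff forall_3)
  show "\<forall>p\<in>Omega_inf. vector [phi p$1 / (1 - phi p$3), phi p$2 / (1 - phi p$3), phi p$3 / (1 - phi p$3)] = p"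
    by (auto simp: Omega_inf_def phi_def vec_eq_iff forall_3 field_simps)
  show "\<forall>q\<in>Omega - {apex}. phi (vector [q$1 / (1 - q$3), q$2 / (1 - q$3), q$3 / (1 - q$3)]) = q"
    using lt by (fastforce simp: phi_def vec_eq_iff forall_3 field_simps)
  show "phi ` Omega_inf \<subseteq> Omega - {apex}"
    by (auto simp: Omega_inf_def Omega_def apex_def phi_def vec_eq_iff forall_3 divide_simps)
  show "(\<lambda>q. vector [q$1 / (1 - q$3), q$2 / (1 - q$3), q$3 / (1 - q$3)]) ` (Omega - {apex}) \<subseteq> Omega_inf"
    using lt by (auto simp: Omega_inf_def) (auto simp: Omega_def field_simps)
qed

lemma bij_betw_pullback1:
  "bij_betw pullback1 (extensional (Omega - {apex})) (extensional Omega_inf)"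
proof -
  define T where "T p = transpose (jacobian phi (at p))" for p
  define psi where "psi = the_inv_into Omega_inf phi"
  have psi: "psi (phi p) = p" if "p \<in> Omega_inf" for p
    using that bij_betw_phi unfolding psi_def bij_betw_def by (simp add: the_inv_into_f_f)
  have phi_psi: "phi (psi q) = q" and psi_in: "psi q \<in> Omega_inf" if "q \<in> Omega - {apex}" for q
    using that bij_betw_phi bij_betw_the_inv_into[OF bij_betw_phi]
    by (auto simp: psi_def f_the_inv_into_f_bij_betw dest: bij_betwE)
  have phi_in: "phi p \<in> Omega - {apex}" if "p \<in> Omega_inf" for p
    using that bij_betw_phi by (meson bij_betwE)
  have inv: "invertible (T p)" if "p \<in> Omega_inf" for p
    using that invertible_jacobian_phi[of p] by (simp add: T_def Omega_inf_def)
  have l: "matrix_inv (T p) *v (T p *v v) = v" and r: "T p *v (matrix_inv (T p) *v v) = v"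
    if "p \<in> Omega_inf" for p v
    using someI_ex[OF inv[OF that, unfolded invertible_def], folded matrix_inv_def]
    by (simp_all add: matrix_vector_mul_assoc)
  show ?thesis
  proof (rule bij_betw_byWitness[where
        f' = "\<lambda>u. \<lambda>q\<in>Omega - {apex}. matrix_inv (T (psi q)) *v u (psi q)"])
    show "\<forall>E\<in>extensional (Omega - {apex}).
        (\<lambda>q\<in>Omega - {apex}. matrix_inv (T (psi q)) *v pullback1 E (psi q)) = E"
    proof
      fix E :: "real^3 \<Rightarrow> real^3" assume E: "E \<in> extensional (Omega - {apex})"
      show "(\<lambda>q\<in>Omega - {apex}. matrix_inv (T (psi q)) *v pullback1 E (psi q)) = E"
        by (rule extensionalityI[OF restrict_extensional E])
           (simp add: pullback1_def T_def[symmetric] psi_in phi_psi l del: Diff_iff)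
    qed
    show "\<forall>u\<in>extensional Omega_inf.
        pullback1 (\<lambda>q\<in>Omega - {apex}. matrix_inv (T (psi q)) *v u (psi q)) = u"
    proof
      fix u :: "real^3 \<Rightarrow> real^3" assume u: "u \<in> extensional Omega_inf"
      show "pullback1 (\<lambda>q\<in>Omega - {apex}. matrix_inv (T (psi q)) *v u (psi q)) = u"
        unfolding pullback1_def T_def[symmetric]
        by (rule extensionalityI[OF restrict_extensional u]) (simp add: phi_in psi r del: Diff_iff)
    qed
  qed (auto simp: pullback1_def)
qed

end

theory Submission
  imports Defs
begin

text \<open>
  If \<open>f\<close> has total degree at most \<open>k - 1\<close>, then \<open>f \<circ> \<phi> = F / (1 + z)\<^sup>k\<^sup>-\<^sup>1\<close> with \<open>F\<close> a combination
  of the functions \<open>x\<^sup>i y\<^sup>j z\<^sup>t (1 + z)\<^sup>k\<^sup>-\<^sup>1\<^sup>-\<^sup>i\<^sup>-\<^sup>j\<^sup>-\<^sup>t\<close>, and the pullback of \<open>(f, g, h)\<close> is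
  \<open>((1 + z) F, (1 + z) G, H - x F - y G) / (1 + z)\<^sup>k\<^sup>+\<^sup>1\<close>. Only the terms with \<open>i = j = 0\<close> have degree
  \<open>k - 1\<close> in \<open>z\<close>, so the top coefficients \<open>\<alpha>, \<beta>, \<gamma>\<close> of \<open>F, G, H\<close> are constants and the excess over
  the \<open>Q\<close> spaces is the special term given by \<open>r = \<alpha> x + \<beta> y - \<gamma>\<close>. On a face \<open>y = const\<close>, expanding
  \<open>z = (1 + z) - 1\<close> splits \<open>F\<close> into a homogeneous polynomial of degree \<open>k - 1\<close> in \<open>w\<close> and \<open>1 + z\<close>
  and a remainder of degree at most \<open>k - 2\<close>, whose product with \<open>(1 + z, -w)\<close> has degree at most
  \<open>k - 1\<close>.
\<close>

section \<open>Finiteness of the index sets and a factorisation of power differences\<close>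

lemma finite_int_le: "finite {i::nat. int i \<le> n}"
  by (rule finite_subset[of _ "{..nat n}"]) auto

lemma finite_degree2: "finite {(i::nat, j::nat). int (i + j) \<le> n}"
  by (rule finite_subset[of _ "{..nat n} \<times> {..nat n}"]) auto

lemma finite_degree3: "finite {(i::nat, j::nat, t::nat). int (i + j + t) \<le> n}"
  by (rule finite_subset[of _ "{..nat n} \<times> {..nat n} \<times> {..nat n}"]) auto

text \<open>The factorisation of \<open>a ^ n - b ^ n\<close> for \<open>a = 1 + z\<close> and
  \<open>b = z\<close>, where the factor \<open>a - b\<close> is 1. It yields the drop of one degree
  both when a leading power of \<open>z\<close> is subtracted and when powers of \<open>z\<close>
  are traded for powers of \<open>1 + z\<close>.\<close>

lemma one_plus_power_diff:
  "(1 + z) ^ n - z ^ n = (\<Sum>p<n. z ^ (n - 1 - p) * (1 + z) ^ p)" for z :: real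
proof (cases n)
  case (Suc m)
  then show ?thesis
    using diff_power_eq_sum[of "1 + z" m z] by (simp add: mult.commute)
qed simp

subsection \<open>Polynomial spaces\<close>

lemma polyQ2_monomial:
  assumes "int a \<le> l" "int b \<le> m"
  shows "(\<lambda>x y. d * x^a * y^b) \<in> polyQ2 l m"
  unfolding polyQ2_def
proof (intro CollectI exI allI)
  fix x y :: real
  \<comment> \<open>The delta coefficient is written with nested conditionals, so that each of the
    nested sums collapses separately.\<close>
  have "(\<Sum>i | int i \<le> l. \<Sum>j | int j \<le> m. (if i = a then if j = b then d else 0 else 0) * x^i * y^j)
      = (\<Sum>i | int i \<le> l. if i = a then \<Sum>j | int j \<le> m. if j = b then d * x^a * y^b else 0 else 0)"
    by (intro sum.cong refl) (auto intro!: sum.cong sum.neutral)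
  also have "\<dots> = d * x^a * y^b"
    using assms by (simp add: finite_int_le)
  finally show "d * x^a * y^b =
    (\<Sum>i | int i \<le> l. \<Sum>j | int j \<le> m. (if i = a then if j = b then d else 0 else 0) * x^i * y^j)"
    by simp
qed

lemma polyQ2_add:
  assumes "u \<in> polyQ2 l m" "v \<in> polyQ2 l m"
  shows "(\<lambda>x y. u x y + v x y) \<in> polyQ2 l m"
proof -
  obtain c d where
    "\<forall>x y. u x y = (\<Sum>i | int i \<le> l. \<Sum>j | int j \<le> m. c i j * x^i * y^j)"
    "\<forall>x y. v x y = (\<Sum>i | int i \<le> l. \<Sum>j | int j \<le> m. d i j * x^i * y^j)"
    using assms unfolding polyQ2_def by blast
  then show ?thesis
    unfolding polyQ2_def
    by (auto simp: sum.distrib distrib_right intro!: exI[of _ "\<lambda>i j. c i j + d i j"])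
qed

lemma polyQ3_monomial:
  assumes "int a \<le> l" "int b \<le> m" "int s \<le> n"
  shows "(\<lambda>x y z. x^a * y^b * z^s) \<in> polyQ3 l m n"
  unfolding polyQ3_def
proof (intro CollectI exI allI)
  fix x y z :: real
  let ?c = "\<lambda>i j t. (if i = a then if j = b then if t = s then 1 else 0 else 0 else 0) :: real"
  have "(\<Sum>i | int i \<le> l. \<Sum>j | int j \<le> m. \<Sum>t | int t \<le> n. ?c i j t * x^i * y^j * z^t)
      = (\<Sum>i | int i \<le> l. if i = a then \<Sum>j | int j \<le> m. if j = b then
          \<Sum>t | int t \<le> n. if t = s then x^a * y^b * z^s else 0 else 0 else 0)"
    by (intro sum.cong refl) (auto intro!: sum.cong sum.neutral)
  also have "\<dots> = x^a * y^b * z^s"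
    using assms by (simp add: finite_int_le)
  finally show "x^a * y^b * z^s =
    (\<Sum>i | int i \<le> l. \<Sum>j | int j \<le> m. \<Sum>t | int t \<le> n. ?c i j t * x^i * y^j * z^t)"
    by simp
qed

lemma polyQ3_add:
  assumes "u \<in> polyQ3 l m n" "v \<in> polyQ3 l m n"
  shows "(\<lambda>x y z. u x y z + v x y z) \<in> polyQ3 l m n"
proof -
  obtain c d where
    "\<forall>x y z. u x y z = (\<Sum>i | int i \<le> l. \<Sum>j | int j \<le> m. \<Sum>t | int t \<le> n. c i j t * x^i * y^j * z^t)"
    "\<forall>x y z. v x y z = (\<Sum>i | int i \<le> l. \<Sum>j | int j \<le> m. \<Sum>t | int t \<le> n. d i j t * x^i * y^j * z^t)"
    using assms unfolding polyQ3_def by blast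
  then show ?thesis
    unfolding polyQ3_def
    by (auto simp: sum.distrib distrib_right intro!: exI[of _ "\<lambda>i j t. c i j t + d i j t"])
qed

lemma polyQ3_scale:
  assumes "u \<in> polyQ3 l m n"
  shows "(\<lambda>x y z. a * u x y z) \<in> polyQ3 l m n"
proof -
  obtain c where
    "\<forall>x y z. u x y z = (\<Sum>i | int i \<le> l. \<Sum>j | int j \<le> m. \<Sum>t | int t \<le> n. c i j t * x^i * y^j * z^t)"
    using assms unfolding polyQ3_def by blast
  then show ?thesis
    unfolding polyQ3_def
    by (auto simp: sum_distrib_left mult.assoc intro!: exI[of _ "\<lambda>i j t. a * c i j t"])
qed

lemma polyQ3_diff:
  assumes "u \<in> polyQ3 l m n" "v \<in> polyQ3 l m n"
  shows "(\<lambda>x y z. u x y z - v x y z) \<in> polyQ3 l m n"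
  using polyQ3_add[OF assms(1) polyQ3_scale[OF assms(2), of "-1"]] by simp

lemma polyQ3_zero: "(\<lambda>x y z. 0) \<in> polyQ3 l m n"
  unfolding polyQ3_def by (auto intro!: exI[of _ "\<lambda>i j t. 0"])

lemma polyQ3_sum:
  assumes "finite A" "\<And>s. s \<in> A \<Longrightarrow> u s \<in> polyQ3 l m n"
  shows "(\<lambda>x y z. \<Sum>s\<in>A. u s x y z) \<in> polyQ3 l m n"
  using assms by (induction A rule: finite_induct) (simp_all add: polyQ3_zero polyQ3_add)

text \<open>The inequalities between degrees leave slack on purpose: \<open>p = q = s = 0\<close>
  gives the inclusion into a space of larger degrees.\<close>

lemma polyQ3_mult_monomial:
  assumes "u \<in> polyQ3 l m n" "l + int p \<le> l'" "m + int q \<le> m'" "n + int s \<le> n'"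
  shows "(\<lambda>x y z. x^p * y^q * z^s * u x y z) \<in> polyQ3 l' m' n'"
proof -
  obtain c where c:
    "\<And>x y z. u x y z = (\<Sum>i | int i \<le> l. \<Sum>j | int j \<le> m. \<Sum>t | int t \<le> n. c i j t * x^i * y^j * z^t)"
    using assms(1) unfolding polyQ3_def by blast
  have "(\<lambda>x y z. \<Sum>i | int i \<le> l. \<Sum>j | int j \<le> m. \<Sum>t | int t \<le> n.
      c i j t * (x^(p + i) * y^(q + j) * z^(s + t))) \<in> polyQ3 l' m' n'"
    using assms(2-) by (intro polyQ3_sum finite_int_le polyQ3_scale polyQ3_monomial) auto
  then show ?thesis
    by (simp add: c sum_distrib_left power_add mult_ac)
qed

text \<open>Binomial expansion of \<open>(1 + z)^d\<close>; only the degree in \<open>z\<close>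
  grows, to at most \<open>s + d\<close>.\<close>

lemma polyQ3_shifted_monomial:
  assumes "int a \<le> l" "int b \<le> m" "int (s + d) \<le> n"
  shows "(\<lambda>x y z. x^a * y^b * z^s * (1 + z)^d) \<in> polyQ3 l m n"
proof -
  have "(\<lambda>x y z. \<Sum>e\<le>d. real (d choose e) * (x^a * y^b * z^(s + e))) \<in> polyQ3 l m n"
    using assms by (intro polyQ3_sum polyQ3_scale polyQ3_monomial) auto
  moreover have "x^a * y^b * z^s * (1 + z)^d = (\<Sum>e\<le>d. real (d choose e) * (x^a * y^b * z^(s + e)))"
    for x y z :: real
    using binomial_ring[of z 1 d] by (simp add: add.commute sum_distrib_left power_add mult_ac)
  ultimately show ?thesis
    by simp
qed

section \<open>Polynomials of bounded total degree in two variables\<close>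

lemma polyP2_monomial:
  assumes "int (a + b) \<le> n"
  shows "(\<lambda>w z. w^a * z^b) \<in> polyP2 n"
  unfolding polyP2_def
proof (intro CollectI exI allI)
  fix w z :: real
  have "(\<Sum>(i, j) | int (i + j) \<le> n. (if (i, j) = (a, b) then 1 else 0) * w^i * z^j)
      = (\<Sum>e | case e of (i, j) \<Rightarrow> int (i + j) \<le> n. if e = (a, b) then w^a * z^b else 0)"
    by (intro sum.cong refl) (auto split: if_splits)
  also have "\<dots> = w^a * z^b"
    using assms finite_degree2[of n] by simp
  finally show "w^a * z^b =
    (\<Sum>(i, j) | int (i + j) \<le> n. (if (i, j) = (a, b) then 1 else 0) * w^i * z^j)"
    by simp
qed

lemma polyP2_add:
  assumes "u \<in> polyP2 n" "v \<in> polyP2 n"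
  shows "(\<lambda>w z. u w z + v w z) \<in> polyP2 n"
proof -
  obtain c d where
    "\<forall>w z. u w z = (\<Sum>(i, j) | int (i + j) \<le> n. c i j * w^i * z^j)"
    "\<forall>w z. v w z = (\<Sum>(i, j) | int (i + j) \<le> n. d i j * w^i * z^j)"
    using assms unfolding polyP2_def by blast
  then show ?thesis
    unfolding polyP2_def
    by (auto simp: sum.distrib[symmetric] distrib_right case_prod_unfold
        intro!: exI[of _ "\<lambda>i j. c i j + d i j"])
qed

lemma polyP2_scale:
  assumes "u \<in> polyP2 n"
  shows "(\<lambda>w z. a * u w z) \<in> polyP2 n"
proof -
  obtain c where "\<forall>w z. u w z = (\<Sum>(i, j) | int (i + j) \<le> n. c i j * w^i * z^j)"
    using assms unfolding polyP2_def by blast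
  then show ?thesis
    unfolding polyP2_def
    by (auto simp: sum_distrib_left mult.assoc case_prod_unfold intro!: exI[of _ "\<lambda>i j. a * c i j"])
qed

lemma polyP2_diff:
  assumes "u \<in> polyP2 n" "v \<in> polyP2 n"
  shows "(\<lambda>w z. u w z - v w z) \<in> polyP2 n"
  using polyP2_add[OF assms(1) polyP2_scale[OF assms(2), of "-1"]] by simp

lemma polyP2_zero: "(\<lambda>w z. 0) \<in> polyP2 n"
  unfolding polyP2_def by (auto simp: case_prod_unfold intro!: exI[of _ "\<lambda>i j. 0"])

lemma polyP2_sum:
  assumes "finite A" "\<And>s. s \<in> A \<Longrightarrow> u s \<in> polyP2 n"
  shows "(\<lambda>w z. \<Sum>s\<in>A. u s w z) \<in> polyP2 n"
  using assms by (induction A rule: finite_induct) (simp_all add: polyP2_zero polyP2_add)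

lemma polyP2_mult_monomial:
  assumes "u \<in> polyP2 n" "n + int (p + s) \<le> n'"
  shows "(\<lambda>w z. w^p * z^s * u w z) \<in> polyP2 n'"
proof -
  obtain c where c: "\<And>w z. u w z = (\<Sum>(i, j) | int (i + j) \<le> n. c i j * w^i * z^j)"
    using assms(1) unfolding polyP2_def by blast
  have "(\<lambda>w z. \<Sum>e | case e of (i, j) \<Rightarrow> int (i + j) \<le> n.
      c (fst e) (snd e) * (w^(p + fst e) * z^(s + snd e))) \<in> polyP2 n'"
    using assms(2) by (intro polyP2_sum finite_degree2 polyP2_scale polyP2_monomial) auto
  then show ?thesis
    by (simp add: c sum_distrib_left power_add mult_ac case_prod_unfold)
qed

lemma polyP2_shifted_monomial:
  assumes "int (a + s + d) \<le> n"
  shows "(\<lambda>w z. w^a * z^s * (1 + z)^d) \<in> polyP2 n"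
proof -
  have "(\<lambda>w z. \<Sum>e\<le>d. real (d choose e) * (w^a * z^(s + e))) \<in> polyP2 n"
    using assms by (intro polyP2_sum polyP2_scale polyP2_monomial) auto
  moreover have "w^a * z^s * (1 + z)^d = (\<Sum>e\<le>d. real (d choose e) * (w^a * z^(s + e)))"
    for w z :: real
    using binomial_ring[of z 1 d] by (simp add: add.commute sum_distrib_left power_add mult_ac)
  ultimately show ?thesis
    by simp
qed

section \<open>Quotients by powers of \<open>1 + z\<close>\<close>

lemma polyQ3_divide_ratQ3:
  assumes "u \<in> polyQ3 l m n"
  shows "(\<lambda>x y z. u x y z / (1 + z)^K) \<in> ratQ3 K l m n"
  unfolding ratQ3_def by (intro CollectI exI[of _ u] conjI refl assms)

lemma polyP2_divide_ratP2:
  assumes "u \<in> polyP2 n"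
  shows "(\<lambda>w z. u w z / (1 + z)^K) \<in> ratP2 K n"
  unfolding ratP2_def by (intro CollectI exI[of _ u] conjI refl assms)

lemma rat_homP2_monomial:
  assumes "int a \<le> n"
  shows "(\<lambda>w z. w^a * (1 + z)^nat (n - int a) / (1 + z)^K) \<in> rat_homP2 K n"
  unfolding rat_homP2_def
proof (intro CollectI exI allI)
  fix w z :: real
  have "(\<Sum>i | int i \<le> n. (if i = a then 1 else 0) * w^i * (1 + z)^nat (n - int i))
      = (\<Sum>i | int i \<le> n. if i = a then w^a * (1 + z)^nat (n - int a) else 0)"
    by (intro sum.cong refl) auto
  also have "\<dots> = w^a * (1 + z)^nat (n - int a)"
    using assms by (simp add: finite_int_le)
  finally show "w^a * (1 + z)^nat (n - int a) / (1 + z)^K =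
    (\<Sum>i | int i \<le> n. (if i = a then 1 else 0) * w^i * (1 + z)^nat (n - int i)) / (1 + z)^K"
    by simp
qed

lemma rat_homP2_add:
  assumes "u \<in> rat_homP2 K n" "v \<in> rat_homP2 K n"
  shows "(\<lambda>w z. u w z + v w z) \<in> rat_homP2 K n"
proof -
  obtain c d where
    "\<forall>w z. u w z = (\<Sum>i | int i \<le> n. c i * w^i * (1 + z)^nat (n - int i)) / (1 + z)^K"
    "\<forall>w z. v w z = (\<Sum>i | int i \<le> n. d i * w^i * (1 + z)^nat (n - int i)) / (1 + z)^K"
    using assms unfolding rat_homP2_def by blast
  then show ?thesis
    unfolding rat_homP2_def
    by (auto simp: sum.distrib distrib_right add_divide_distrib intro!: exI[of _ "\<lambda>i. c i + d i"])
qed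

lemma rat_homP2_scale:
  assumes "u \<in> rat_homP2 K n"
  shows "(\<lambda>w z. a * u w z) \<in> rat_homP2 K n"
proof -
  obtain c where
    "\<forall>w z. u w z = (\<Sum>i | int i \<le> n. c i * w^i * (1 + z)^nat (n - int i)) / (1 + z)^K"
    using assms unfolding rat_homP2_def by blast
  then show ?thesis
    unfolding rat_homP2_def
    by (auto simp: sum_distrib_left mult.assoc intro!: exI[of _ "\<lambda>i. a * c i"])
qed

lemma rat_homP2_zero: "(\<lambda>w z. 0) \<in> rat_homP2 K n"
  unfolding rat_homP2_def by (auto intro!: exI[of _ "\<lambda>i. 0"])

lemma rat_homP2_sum:
  assumes "finite A" "\<And>s. s \<in> A \<Longrightarrow> u s \<in> rat_homP2 K n"
  shows "(\<lambda>w z. \<Sum>s\<in>A. u s w z) \<in> rat_homP2 K n"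
  using assms by (induction A rule: finite_induct) (simp_all add: rat_homP2_zero rat_homP2_add)

subsection \<open>Polynomials in the coordinates of the infinite pyramid\<close>

text \<open>The degree in \<open>z\<close> is \<open>t + d\<close>, which is below \<open>n\<close>
  unless \<open>i = j = 0\<close>. In that case the product is monic of degree \<open>n\<close> in
  \<open>z\<close>, and subtracting \<open>z^n\<close> removes the leading term.\<close>

lemma top_part_in_z:
  assumes "i + j + t + d = n"
  shows "(\<lambda>x y z. x^i * y^j * z^t * (1 + z)^d - (if i = 0 \<and> j = 0 then z^n else 0))
    \<in> polyQ3 (int n) (int n) (int n - 1)"
proof (cases "i = 0 \<and> j = 0")
  case True
  have "(\<lambda>x y z. \<Sum>p<d. x^0 * y^0 * z^(t + (d - 1 - p)) * (1 + z)^p)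
      \<in> polyQ3 (int n) (int n) (int n - 1)"
    using assms by (intro polyQ3_sum polyQ3_shifted_monomial) auto
  moreover have "(\<Sum>p<d. x^0 * y^0 * z^(t + (d - 1 - p)) * (1 + z)^p) = z^t * (1 + z)^d - z^n"
    for x y z :: real
  proof -
    have "z^t * (1 + z)^d - z^n = z^t * ((1 + z)^d - z^d)"
      using assms True by (simp add: power_add[symmetric] right_diff_distrib)
    also have "\<dots> = (\<Sum>p<d. x^0 * y^0 * z^(t + (d - 1 - p)) * (1 + z)^p)"
      unfolding one_plus_power_diff sum_distrib_left
      by (intro sum.cong) (simp_all only: power_add power_0 mult_1 mult.assoc)
    finally show ?thesis ..
  qed
  ultimately show ?thesis
    using True by simp
next
  case False
  then have "(\<lambda>x y z. x^i * y^j * z^t * (1 + z)^d) \<in> polyQ3 (int n) (int n) (int n - 1)"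
    using assms by (intro polyQ3_shifted_monomial) auto
  with False show ?thesis
    by (simp only: if_False diff_zero)
qed

lemma homogeneous_part:
  assumes "i + j + t + d = n"
  shows "(\<lambda>w z. w^i * b^j * z^t * (1 + z)^d - (if j = 0 then w^i * (1 + z)^(n - i) else 0))
    \<in> polyP2 (int n - 1)"
proof (cases "j = 0")
  case True
  have "(\<lambda>w z. (-1) * (\<Sum>p<t. w^i * z^(t - 1 - p) * (1 + z)^(d + p))) \<in> polyP2 (int n - 1)"
    using assms by (intro polyP2_scale polyP2_sum polyP2_shifted_monomial) auto
  moreover have "(-1) * (\<Sum>p<t. w^i * z^(t - 1 - p) * (1 + z)^(d + p))
      = w^i * z^t * (1 + z)^d - w^i * (1 + z)^(n - i)" for w z :: real
  proof -
    have "n - i = t + d"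
      using assms True by simp
    then have "w^i * z^t * (1 + z)^d - w^i * (1 + z)^(n - i)
        = - (w^i * (1 + z)^d * ((1 + z)^t - z^t))"
      by (simp add: power_add algebra_simps)
    then show ?thesis
      by (simp add: one_plus_power_diff sum_distrib_left sum_negf power_add mult_ac)
  qed
  ultimately show ?thesis
    using True by simp
next
  case False
  then have "(\<lambda>w z. b^j * (w^i * z^t * (1 + z)^d)) \<in> polyP2 (int n - 1)"
    using assms by (intro polyP2_scale polyP2_shifted_monomial) auto
  with False show ?thesis
    by (simp add: mult_ac)
qed

text \<open>\<open>Q\<close> stands for the part homogeneous in \<open>w\<close> and
  \<open>1 + z\<close>; it enters through its quotient because \<open>rat_homP2\<close> consists of
  quotients. The remainder of degree \<open>k - 2\<close> leaves room for a later multiplication by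
  \<open>1 + z\<close> or \<open>w\<close>.\<close>

definition face_poly :: "nat \<Rightarrow> (real \<Rightarrow> real \<Rightarrow> real) \<Rightarrow> bool" where
  "face_poly k F \<longleftrightarrow> F \<in> polyP2 (int k - 1) \<and>
     (\<exists>Q. (\<lambda>w z. Q w z / (1 + z)^(k + 1)) \<in> rat_homP2 (k + 1) (int k - 1) \<and>
     (\<lambda>w z. F w z - Q w z) \<in> polyP2 (int k - 2))"

text \<open>The exponents are functions on an abstract index set, so that the faces of constant
  \<open>x\<close> and of constant \<open>y\<close> are both instances, with \<open>i\<close> and
  \<open>j\<close> exchanged.\<close>

lemma face_poly_combination:
  assumes "finite A" "k \<ge> 1"
    and A: "\<And>e. e \<in> A \<Longrightarrow> i e + j e + t e + d e = k - 1"
  shows "face_poly k (\<lambda>w z. \<Sum>e\<in>A. c e * (w^i e * b^j e * z^t e * (1 + z)^d e))"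
  unfolding face_poly_def
proof (intro exI conjI)
  have "(\<lambda>w z. \<Sum>e\<in>A. c e * b^j e * (w^i e * z^t e * (1 + z)^d e)) \<in> polyP2 (int k - 1)"
  proof (intro polyP2_sum polyP2_scale polyP2_shifted_monomial \<open>finite A\<close>)
    fix e assume "e \<in> A"
    then show "int (i e + t e + d e) \<le> int k - 1"
      using A[of e] \<open>k \<ge> 1\<close> by linarith
  qed
  then show "(\<lambda>w z. \<Sum>e\<in>A. c e * (w^i e * b^j e * z^t e * (1 + z)^d e)) \<in> polyP2 (int k - 1)"
    by (simp only: mult_ac)
  \<comment> \<open>The homogeneous monomial belonging to the index \<open>e\<close>. The
    combination of the \<open>?q e\<close> with coefficients \<open>c e\<close> becomes the witness
    \<open>Q\<close>.\<close>
  let ?q = "\<lambda>e w z :: real. if j e = 0 then w^i e * (1 + z)^(k - 1 - i e) else 0"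
  have "(\<lambda>w z. ?q e w z / (1 + z)^(k + 1)) \<in> rat_homP2 (k + 1) (int k - 1)" if "e \<in> A" for e
  proof -
    have "int (i e) \<le> int k - 1" and "nat (int k - 1 - int (i e)) = k - 1 - i e"
      using A[OF that] \<open>k \<ge> 1\<close> by auto
    then show ?thesis
      using rat_homP2_monomial[of "i e" "int k - 1" "k + 1"] rat_homP2_zero
      by (cases "j e = 0") simp_all
  qed
  then have "(\<lambda>w z. \<Sum>e\<in>A. c e * (?q e w z / (1 + z)^(k + 1))) \<in> rat_homP2 (k + 1) (int k - 1)"
    using \<open>finite A\<close> by (intro rat_homP2_sum rat_homP2_scale) auto
  then show "(\<lambda>w z. (\<Sum>e\<in>A. c e * ?q e w z) / (1 + z)^(k + 1)) \<in> rat_homP2 (k + 1) (int k - 1)"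
    by (simp only: sum_divide_distrib times_divide_eq_right)
  \<comment> \<open>\<open>homogeneous_part\<close> with \<open>n = k - 1\<close>; its bound
    \<open>int (k - 1) - 1\<close> equals \<open>int k - 2\<close> because
    \<open>k \<ge> 1\<close>.\<close>
  have "(\<lambda>w z. \<Sum>e\<in>A. c e * (w^i e * b^j e * z^t e * (1 + z)^d e - ?q e w z))
      \<in> polyP2 (int (k - 1) - 1)"
    using \<open>finite A\<close> A by (intro polyP2_sum polyP2_scale homogeneous_part) auto
  then show "(\<lambda>w z. (\<Sum>e\<in>A. c e * (w^i e * b^j e * z^t e * (1 + z)^d e)) - (\<Sum>e\<in>A. c e * ?q e w z))
      \<in> polyP2 (int k - 2)"
    using \<open>k \<ge> 1\<close> by (simp only: right_diff_distrib sum_subtractf) (simp add: of_nat_diff)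
qed

text \<open>One numerator \<open>F\<close> serves the volume condition and all faces. For
  \<open>k = 1\<close> the degree \<open>int k - 2\<close> is negative, and the second claim says
  that \<open>F\<close> is the constant \<open>\<alpha>\<close>.\<close>

lemma polyP3_transport:
  assumes "f \<in> polyP3 (int k - 1)" "k \<ge> 1"
  obtains F \<alpha> where
    "\<And>x y z. z \<ge> 0 \<Longrightarrow> f (x / (1 + z)) (y / (1 + z)) (z / (1 + z)) = F x y z / (1 + z)^(k - 1)"
    "(\<lambda>x y z. F x y z - \<alpha> * z^(k - 1)) \<in> polyQ3 (int k - 1) (int k - 1) (int k - 2)"
    "\<And>y. face_poly k (\<lambda>w z. F w y z)"
    "\<And>x. face_poly k (\<lambda>w z. F x w z)"
proof -
  let ?A = "{(i::nat, j::nat, t::nat). int (i + j + t) \<le> int k - 1}"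
  obtain c where c: "\<And>x y z. f x y z = (\<Sum>(i, j, t)\<in>?A. c i j t * x^i * y^j * z^t)"
    using assms(1) unfolding polyP3_def by blast
  define i where "i = (\<lambda>e::nat \<times> nat \<times> nat. fst e)"
  define j where "j = (\<lambda>e::nat \<times> nat \<times> nat. fst (snd e))"
  define t where "t = (\<lambda>e::nat \<times> nat \<times> nat. snd (snd e))"
  \<comment> \<open>The power of \<open>1 + z\<close> that brings a term to the common denominator;
    the subtraction is exact on \<open>?A\<close>.\<close>
  define d where "d e = k - 1 - (i e + j e + t e)" for e
  define C where "C e = c (i e) (j e) (t e)" for e
  have d: "i e + j e + t e + d e = k - 1" if "e \<in> ?A" for e
    using that by (auto simp: i_def j_def t_def d_def)
  have fin: "finite ?A"
    by (rule finite_degree3)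
  have f: "f x y z = (\<Sum>e\<in>?A. C e * (x^i e * y^j e * z^t e))" for x y z
    by (simp add: c C_def i_def j_def t_def case_prod_unfold mult.assoc)
  define F where "F x y z = (\<Sum>e\<in>?A. C e * (x^i e * y^j e * z^t e * (1 + z)^d e))" for x y z
  \<comment> \<open>\<open>z^t * (1 + z)^d\<close> is monic in \<open>z\<close>, so every term free
    of \<open>x\<close> and \<open>y\<close> contributes its full coefficient, whatever its
    \<open>t\<close>.\<close>
  define \<alpha> where "\<alpha> = (\<Sum>e\<in>?A. C e * (if i e = 0 \<and> j e = 0 then 1 else 0))"
  show thesis
  proof (rule that[of F \<alpha>])
    fix x y z :: real assume "z \<ge> 0"
    then have nz: "1 + z \<noteq> 0" by simp
    have "(x / (1 + z))^i e * (y / (1 + z))^j e * (z / (1 + z))^t e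
        = x^i e * y^j e * z^t e * (1 + z)^d e / (1 + z)^(k - 1)" if "e \<in> ?A" for e
      using nz unfolding d[OF that, symmetric] by (simp add: power_divide power_add)
    then show "f (x / (1 + z)) (y / (1 + z)) (z / (1 + z)) = F x y z / (1 + z)^(k - 1)"
      unfolding f F_def sum_divide_distrib by (intro sum.cong) auto
  next
    have "(\<lambda>x y z. \<Sum>e\<in>?A. C e * (x^i e * y^j e * z^t e * (1 + z)^d e
        - (if i e = 0 \<and> j e = 0 then z^(k - 1) else 0)))
      \<in> polyQ3 (int (k - 1)) (int (k - 1)) (int (k - 1) - 1)"
      by (intro polyQ3_sum polyQ3_scale top_part_in_z fin d)
    moreover have "F x y z - \<alpha> * z^(k - 1) = (\<Sum>e\<in>?A. C e * (x^i e * y^j e * z^t e * (1 + z)^d e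
        - (if i e = 0 \<and> j e = 0 then z^(k - 1) else 0)))" for x y z
      unfolding F_def \<alpha>_def sum_distrib_right sum_subtractf[symmetric]
      by (intro sum.cong) (auto simp: right_diff_distrib)
    ultimately show "(\<lambda>x y z. F x y z - \<alpha> * z^(k - 1)) \<in> polyQ3 (int k - 1) (int k - 1) (int k - 2)"
      using \<open>k \<ge> 1\<close> by (simp add: of_nat_diff)
  next
    fix y show "face_poly k (\<lambda>w z. F w y z)"
      unfolding F_def by (rule face_poly_combination[OF fin \<open>k \<ge> 1\<close> d])
  next
    fix x
    \<comment> \<open>The free variable is now \<open>y\<close>, whose exponent is \<open>j\<close>,
      and \<open>x\<close> is frozen.\<close>
    have "face_poly k (\<lambda>w z. \<Sum>e\<in>?A. C e * (w^j e * x^i e * z^t e * (1 + z)^d e))"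
      using d by (intro face_poly_combination[OF fin \<open>k \<ge> 1\<close>]) (simp add: add_ac)
    then show "face_poly k (\<lambda>w z. F x w z)"
      unfolding F_def by (simp only: mult.commute)
  qed
qed

subsection \<open>The pulled back field\<close>

text \<open>\<open>F\<close> belongs to the tangential direction \<open>w\<close>, \<open>G\<close>
  to the normal direction, in which the coordinate is \<open>b\<close>. With
  \<open>F = Q + R\<close> the numerators are \<open>Q\<close> times \<open>(1 + z, -w)\<close> plus
  the pair \<open>R * (1 + z)\<close> and \<open>H - b * G - w * R\<close>, of degree at most
  \<open>k - 1\<close> since \<open>R\<close> has degree at most \<open>k - 2\<close>.\<close>

lemma face_trace_in_face_traces1:
  assumes "face_poly k F" "face_poly k G" "face_poly k H"
  shows "(\<lambda>w z. (F w z * (1 + z) / (1 + z)^(k + 1), (H w z - w * F w z - b * G w z) / (1 + z)^(k + 1)))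
    \<in> face_traces1 k"
proof -
  obtain Q where Q: "(\<lambda>w z. Q w z / (1 + z)^(k + 1)) \<in> rat_homP2 (k + 1) (int k - 1)"
    and R: "(\<lambda>w z. F w z - Q w z) \<in> polyP2 (int k - 2)"
    using assms(1) unfolding face_poly_def by blast
  have wR: "(\<lambda>w z. w * (F w z - Q w z)) \<in> polyP2 (int k - 1)"
    using polyP2_mult_monomial[OF R, of 1 0 "int k - 1"] by simp
  have "(\<lambda>w z. F w z - Q w z) \<in> polyP2 (int k - 1)" "(\<lambda>w z. z * (F w z - Q w z)) \<in> polyP2 (int k - 1)"
    using polyP2_mult_monomial[OF R, of 0 0 "int k - 1"] polyP2_mult_monomial[OF R, of 0 1 "int k - 1"]
    by simp_all
  from polyP2_add[OF this] have zR: "(\<lambda>w z. (F w z - Q w z) * (1 + z)) \<in> polyP2 (int k - 1)"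
    by (simp add: algebra_simps)
  have wHG: "(\<lambda>w z. (H w z - b * G w z) - w * (F w z - Q w z)) \<in> polyP2 (int k - 1)"
  proof -
    have "G \<in> polyP2 (int k - 1)" "H \<in> polyP2 (int k - 1)"
      using assms(2,3) unfolding face_poly_def by blast+
    from polyP2_diff[OF polyP2_diff[OF this(2) polyP2_scale[OF this(1)]] wR] show ?thesis .
  qed
  define p where "p w z = (F w z - Q w z) * (1 + z) / (1 + z)^(k + 1)" for w z
  define p' where "p' w z = ((H w z - b * G w z) - w * (F w z - Q w z)) / (1 + z)^(k + 1)" for w z
  define q where "q w z = Q w z / (1 + z)^(k + 1)" for w z
  have "p \<in> ratP2 (k + 1) (int k - 1)"
    unfolding p_def[abs_def] by (rule polyP2_divide_ratP2[OF zR])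
  moreover have "p' \<in> ratP2 (k + 1) (int k - 1)"
    unfolding p'_def[abs_def] by (rule polyP2_divide_ratP2[OF wHG])
  moreover have "q \<in> rat_homP2 (k + 1) (int k - 1)"
    unfolding q_def[abs_def] by (rule Q)
  moreover have "F w z * (1 + z) / (1 + z)^(k + 1) = p w z + q w z * (1 + z)"
    and "(H w z - w * F w z - b * G w z) / (1 + z)^(k + 1) = p' w z + q w z * (- w)" for w z
    unfolding p_def p'_def q_def times_divide_eq_left add_divide_distrib[symmetric]
    \<comment> \<open>Only numerators over the common denominator are compared, so
      \<open>z = -1\<close> is covered as well.\<close>
    by (rule arg_cong[of _ _ "\<lambda>a. a / (1 + z)^(k + 1)"], simp add: algebra_simps)+
  ultimately show ?thesis
    unfolding face_traces1_def
    by (intro CollectI exI[of _ p] exI[of _ p'] exI[of _ q] conjI) simp_all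
qed

text \<open>The off-diagonal partial derivatives of \<open>phi\<close> are all taken with respect to
  \<open>z\<close>, so the transposed Jacobian mixes components only in the third entry.\<close>

lemma pullback1_eq:
  assumes "p \<in> Omega_inf"
  shows "pullback1 E p = (let v = E (phi p) in
    vector [v$1 / (1 + p$3), v$2 / (1 + p$3), (v$3 - p$1 * v$1 - p$2 * v$2) / (1 + p$3)^2])"
proof -
  have z: "p$3 \<ge> 0"
    using assms by (simp add: Omega_inf_def)
  have J: "jacobian phi (at p) = (\<chi> i j. vector [
            axis j 1$1 / (1 + p$3) - p$1 * axis j 1$3 / (1 + p$3)^2,
            axis j 1$2 / (1 + p$3) - p$2 * axis j 1$3 / (1 + p$3)^2,
            axis j 1$3 / (1 + p$3)^2] $ i)"
    unfolding jacobian_def frechet_derivative_at[OF has_derivative_phi[OF z], symmetric]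
      matrix_def ..
  have "pullback1 E p = transpose (jacobian phi (at p)) *v E (phi p)"
    using assms by (simp add: pullback1_def)
  also have "\<dots> = (let v = E (phi p) in
    vector [v$1 / (1 + p$3), v$2 / (1 + p$3), (v$3 - p$1 * v$1 - p$2 * v$2) / (1 + p$3)^2])"
    unfolding J Let_def vec_eq_iff forall_3
    by (simp add: matrix_vector_mult_def transpose_def sum_3 axis_def
        add_divide_distrib diff_divide_distrib)
  finally show ?thesis .
qed

text \<open>A single \<open>r\<close> has to absorb the excess of all three components. The third
  one, \<open>z^(k - 1)\<close> times \<open>\<gamma> - \<alpha> * x - \<beta> * y\<close>,
  determines \<open>r\<close>, and the partial derivatives \<open>\<alpha>\<close> and
  \<open>\<beta>\<close> of this \<open>r\<close> match the excess of the other two.\<close>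

lemma volume1_member:
  assumes "k \<ge> 1" "u \<in> extensional Omega_inf"
    and F: "(\<lambda>x y z. F x y z - \<alpha> * z^(k - 1)) \<in> polyQ3 (int k - 1) (int k - 1) (int k - 2)"
    and G: "(\<lambda>x y z. G x y z - \<beta> * z^(k - 1)) \<in> polyQ3 (int k - 1) (int k - 1) (int k - 2)"
    and H: "(\<lambda>x y z. H x y z - \<gamma> * z^(k - 1)) \<in> polyQ3 (int k - 1) (int k - 1) (int k - 2)"
    and u: "\<And>x y z. vector [x, y, z] \<in> Omega_inf \<Longrightarrow> u (vector [x, y, z]) =
      vector [F x y z * (1 + z) / (1 + z)^(k + 1), G x y z * (1 + z) / (1 + z)^(k + 1),
        (H x y z - x * F x y z - y * G x y z) / (1 + z)^(k + 1)]"
  shows "u \<in> volume1 k"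
proof -
  \<comment> \<open>Multiplying \<open>A - a * z^(k - 1)\<close> by \<open>1 + z\<close> gives
    degree at most \<open>k - 1\<close> in \<open>z\<close>; it differs from the claimed function
    only by \<open>a * z^(k - 1)\<close>.\<close>
  have shift: "(\<lambda>x y z. A x y z * (1 + z) - a * z^k) \<in> polyQ3 l m (int k - 1)"
    if A: "(\<lambda>x y z. A x y z - a * z^(k - 1)) \<in> polyQ3 (int k - 1) (int k - 1) (int k - 2)"
      and "l \<ge> int k - 1" "m \<ge> int k - 1" for A a l m
  proof -
    note M = polyQ3_mult_monomial[OF A, of 0 l 0 m _ "int k - 1"]
    have "(\<lambda>x y z. z^(k - 1)) \<in> polyQ3 l m (int k - 1)"
      using polyQ3_monomial[of 0 l 0 m "k - 1" "int k - 1"] that \<open>k \<ge> 1\<close> by simp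
    from polyQ3_add[OF polyQ3_add[OF M[of 0] M[of 1]] polyQ3_scale[OF this, of a]]
    have "(\<lambda>x y z. (A x y z - a * z^(k - 1)) + z * (A x y z - a * z^(k - 1)) + a * z^(k - 1))
        \<in> polyQ3 l m (int k - 1)"
      using that by simp
    moreover have "z * z^(k - 1) = z^k" for z :: real
      using \<open>k \<ge> 1\<close> power_minus_mult[of k z] by (simp add: mult.commute)
    then have "(A x y z - a * z^(k - 1)) + z * (A x y z - a * z^(k - 1)) + a * z^(k - 1)
        = A x y z * (1 + z) - a * z^k" for x y z
      by (simp add: algebra_simps)
    ultimately show ?thesis by simp
  qed
  \<comment> \<open>With the top powers of \<open>z\<close> stripped off, multiplication by
    \<open>x\<close> or \<open>y\<close> raises only the degree in that variable.\<close>
  let ?h = "\<lambda>x y z. (H x y z - \<gamma> * z^(k - 1)) - x * (F x y z - \<alpha> * z^(k - 1))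
      - y * (G x y z - \<beta> * z^(k - 1))"
  have h: "?h \<in> polyQ3 (int k) (int k) (int k - 2)"
    using polyQ3_diff[OF polyQ3_diff[OF
          polyQ3_mult_monomial[OF H, of 0 "int k" 0 "int k" 0 "int k - 2"]
          polyQ3_mult_monomial[OF F, of 1 "int k" 0 "int k" 0 "int k - 2"]]
          polyQ3_mult_monomial[OF G, of 0 "int k" 1 "int k" 0 "int k - 2"]] by simp
  let ?r = "\<lambda>x y. \<alpha> * x + \<beta> * y - \<gamma>"
  have r: "?r \<in> polyQ2 (int k) (int k)"
    using polyQ2_add[OF polyQ2_add[OF polyQ2_monomial[of 1 "int k" 0 "int k" \<alpha>]
        polyQ2_monomial[of 0 "int k" 1 "int k" \<beta>]] polyQ2_monomial[of 0 "int k" 0 "int k" "- \<gamma>"]]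
      \<open>k \<ge> 1\<close> by simp
  have dx: "deriv (\<lambda>s. ?r s y) x = \<alpha>" for x y
    by (rule DERIV_imp_deriv) (auto intro!: derivative_eq_intros)
  have dy: "deriv (\<lambda>s. ?r x s) y = \<beta>" for x y
    by (rule DERIV_imp_deriv) (auto intro!: derivative_eq_intros)
  show ?thesis
    unfolding volume1_def
  proof (intro CollectI conjI bexI allI impI)
    show "(\<lambda>x y z. (F x y z * (1 + z) - \<alpha> * z^k) / (1 + z)^(k + 1))
        \<in> ratQ3 (k + 1) (int k - 1) (int k) (int k - 1)"
      by (rule polyQ3_divide_ratQ3, rule shift[OF F]) simp_all
    show "(\<lambda>x y z. (G x y z * (1 + z) - \<beta> * z^k) / (1 + z)^(k + 1))
        \<in> ratQ3 (k + 1) (int k) (int k - 1) (int k - 1)"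
      by (rule polyQ3_divide_ratQ3, rule shift[OF G]) simp_all
    show "(\<lambda>x y z. ?h x y z / (1 + z)^(k + 1)) \<in> ratQ3 (k + 1) (int k) (int k) (int k - 2)"
      by (rule polyQ3_divide_ratQ3[OF h])
    show "?r \<in> polyQ2 (int k) (int k)"
      by (rule r)
    show "u \<in> extensional Omega_inf"
      by (rule assms(2))
    fix x y z :: real assume p: "vector [x, y, z] \<in> Omega_inf"
    have zk: "z^k = z^(k - 1) * z"
      using \<open>k \<ge> 1\<close> power_minus_mult[of k z] by simp
    have 1: "F x y z * (1 + z) = (F x y z * (1 + z) - \<alpha> * z^k) + z^(k - 1) * (\<alpha> * z)"
      by (simp add: zk)
    have 2: "G x y z * (1 + z) = (G x y z * (1 + z) - \<beta> * z^k) + z^(k - 1) * (\<beta> * z)"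
      by (simp add: zk)
    have 3: "H x y z - x * F x y z - y * G x y z = ?h x y z + z^(k - 1) * (- ?r x y)"
      by (simp add: algebra_simps)
    show "u (vector [x, y, z]) =
        vector [(F x y z * (1 + z) - \<alpha> * z^k) / (1 + z)^(k + 1),
          (G x y z * (1 + z) - \<beta> * z^k) / (1 + z)^(k + 1), ?h x y z / (1 + z)^(k + 1)]
        + (z^(k - 1) / (1 + z)^(k + 1)) *\<^sub>R
          vector [deriv (\<lambda>s. ?r s y) x * z, deriv (\<lambda>s. ?r x s) y * z, - ?r x y]"
      unfolding u[OF p] dx dy vec_eq_iff forall_3
      by (simp only: vector_3 vector_add_component vector_scaleR_component real_scaleR_def
          times_divide_eq_left add_divide_distrib[symmetric] 1[symmetric] 2[symmetric] 3[symmetric])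
  qed
qed

text \<open>The restriction puts the field into the domain on which \<open>pullback1\<close> is
  bijective; the values at points \<open>phi p\<close> are unaffected, since \<open>phi\<close>
  misses the apex.\<close>

lemma pullback1_poly_field:
  assumes "k \<ge> 1" "E \<in> poly_fields (int k - 1)"
  shows "pullback1 (restrict E (Omega - {apex})) \<in> U1_inf k"
proof -
  obtain f g h where E: "E = (\<lambda>p\<in>Omega. vector [f (p$1) (p$2) (p$3), g (p$1) (p$2) (p$3), h (p$1) (p$2) (p$3)])"
    and fgh: "f \<in> polyP3 (int k - 1)" "g \<in> polyP3 (int k - 1)" "h \<in> polyP3 (int k - 1)"
    using assms(2) unfolding poly_fields_def by blast
  obtain F \<alpha> where
    f: "\<And>x y z. z \<ge> 0 \<Longrightarrow> f (x / (1 + z)) (y / (1 + z)) (z / (1 + z)) = F x y z / (1 + z)^(k - 1)" and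
    F: "(\<lambda>x y z. F x y z - \<alpha> * z^(k - 1)) \<in> polyQ3 (int k - 1) (int k - 1) (int k - 2)"
      "\<And>y. face_poly k (\<lambda>w z. F w y z)" "\<And>x. face_poly k (\<lambda>w z. F x w z)"
    using polyP3_transport[OF fgh(1) assms(1)] by blast
  obtain G \<beta> where
    g: "\<And>x y z. z \<ge> 0 \<Longrightarrow> g (x / (1 + z)) (y / (1 + z)) (z / (1 + z)) = G x y z / (1 + z)^(k - 1)" and
    G: "(\<lambda>x y z. G x y z - \<beta> * z^(k - 1)) \<in> polyQ3 (int k - 1) (int k - 1) (int k - 2)"
      "\<And>y. face_poly k (\<lambda>w z. G w y z)" "\<And>x. face_poly k (\<lambda>w z. G x w z)"
    using polyP3_transport[OF fgh(2) assms(1)] by blast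
  obtain H \<gamma> where
    h: "\<And>x y z. z \<ge> 0 \<Longrightarrow> h (x / (1 + z)) (y / (1 + z)) (z / (1 + z)) = H x y z / (1 + z)^(k - 1)" and
    H: "(\<lambda>x y z. H x y z - \<gamma> * z^(k - 1)) \<in> polyQ3 (int k - 1) (int k - 1) (int k - 2)"
      "\<And>y. face_poly k (\<lambda>w z. H w y z)" "\<And>x. face_poly k (\<lambda>w z. H x w z)"
    using polyP3_transport[OF fgh(3) assms(1)] by blast
  let ?u = "pullback1 (restrict E (Omega - {apex}))"
  have u: "?u (vector [x, y, z]) =
      vector [F x y z * (1 + z) / (1 + z)^(k + 1), G x y z * (1 + z) / (1 + z)^(k + 1),
        (H x y z - x * F x y z - y * G x y z) / (1 + z)^(k + 1)]"
    if p: "vector [x, y, z] \<in> Omega_inf" for x y z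
  proof -
    have z: "z \<ge> 0"
      using p by (simp add: Omega_inf_def)
    have "phi (vector [x, y, z]) \<in> Omega - {apex}"
      using bij_betw_phi p by (meson bij_betwE)
    then have v: "restrict E (Omega - {apex}) (phi (vector [x, y, z])) =
        vector [F x y z / (1 + z)^(k - 1), G x y z / (1 + z)^(k - 1), H x y z / (1 + z)^(k - 1)]"
      by (simp add: E phi_def f[OF z] g[OF z] h[OF z])
    \<comment> \<open>The pullback divides the first two components by \<open>1 + z\<close> and the
      third by its square; the common denominator therefore leaves a factor \<open>1 + z\<close> in
      the first two numerators.\<close>
    have s: "(1 + z)^(k + 1) = (1 + z)^2 * (1 + z)^(k - 1)" and "1 + z \<noteq> 0"
      using z assms(1) by (simp_all flip: power_add)
    then have "a / (1 + z)^(k - 1) / (1 + z) = a * (1 + z) / (1 + z)^(k + 1)" for a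
      unfolding s by (simp add: power2_eq_square)
    moreover have "(c / (1 + z)^(k - 1) - x * (a / (1 + z)^(k - 1)) - y * (b / (1 + z)^(k - 1))) / (1 + z)^2
        = (c - x * a - y * b) / (1 + z)^(k + 1)" for a b c
      unfolding s by (simp add: diff_divide_distrib mult.commute)
    ultimately show ?thesis
      unfolding pullback1_eq[OF p] v Let_def vector_3 by (simp only:)
  qed
  have "?u \<in> volume1 k"
    by (rule volume1_member[OF assms(1) _ F(1) G(1) H(1) u]) (simp add: pullback1_def restrict_extensional del: Diff_iff restrict_apply)
  moreover have "\<exists>T\<in>face_traces1 k. \<forall>w z. 0 \<le> w \<and> w \<le> 1 \<and> 0 \<le> z \<longrightarrow>
      (?u (vector [w, y, z]) $ 1, ?u (vector [w, y, z]) $ 3) = T w z" if "y \<in> {0, 1}" for y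
    by (rule bexI[OF _ face_trace_in_face_traces1[OF F(2)[of y] G(2)[of y] H(2)[of y], of y]])
      (use that in \<open>auto simp: u Omega_inf_def\<close>)
  \<comment> \<open>On a face of constant \<open>x\<close>, \<open>G\<close> is tangential and
    \<open>F\<close> normal, so the two exchange their roles.\<close>
  moreover have "\<exists>T\<in>face_traces1 k. \<forall>w z. 0 \<le> w \<and> w \<le> 1 \<and> 0 \<le> z \<longrightarrow>
      (?u (vector [x, w, z]) $ 2, ?u (vector [x, w, z]) $ 3) = T w z" if "x \<in> {0, 1}" for x
    by (rule bexI[OF _ face_trace_in_face_traces1[OF G(3)[of x] F(3)[of x] H(3)[of x], of x]])
      (use that in \<open>auto simp: u Omega_inf_def algebra_simps\<close>)
  ultimately show ?thesis
    unfolding U1_inf_def by blast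
qed

theorem lemma8p3:
  fixes k :: nat
  assumes "k \<ge> 1"
  shows "(\<lambda>E. restrict E (Omega - {apex})) ` poly_fields (int k - 1) \<subseteq> U1 k"
proof (intro image_subsetI)
  fix E assume "E \<in> poly_fields (int k - 1)"
  then have "pullback1 (restrict E (Omega - {apex})) \<in> U1_inf k"
    by (rule pullback1_poly_field[OF assms])
  \<comment> \<open>Injectivity of \<open>pullback1\<close> on extensional fields makes the chosen
    inverse return the field itself.\<close>
  moreover have "inv_pullback1 (pullback1 (restrict E (Omega - {apex}))) = restrict E (Omega - {apex})"
    unfolding inv_pullback1_def
    by (rule the_inv_into_f_f) (use bij_betw_pullback1 in \<open>auto simp: bij_betw_def\<close>)
  ultimately show "restrict E (Omega - {apex}) \<in> U1 k"
    unfolding U1_def by (metis image_eqI)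
qed

end
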